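(* Consider the Cournot model with endogenous period-1 capacity and no period-2 expansion described in the context, and assume that for each $R\in\{P,F\}$ the function $F^R$ is strictly decreasing on $(0,\infty)$ and has a unique interior root $K^R_\star>0$. At any common capacity $K>0$ define $$\Delta(K)=\Delta_0(K)+\Delta_{\mathrm{comp}}(K),$$ $$\Delta_0(K)=a\Bigl[\bigl(\eta(2K)-\eta(K)\bigr)+K\bigl(\eta'(2K)-\eta'(K)\bigr)\Bigr],$$ $$\Delta_{\mathrm{comp}}(K)=-3bK\bigl(\eta(2K)^2-\eta(K)^2\bigr)-bK^2\bigl(4\eta(2K)\eta'(2K)-3\eta(K)\eta'(K)\bigr).$$ Then $K^P_\star$ exceeds, equals, or falls short of $K^F_\star$ according as $\Delta(K^F_\star)$ is positive, zero, or negative. Moreover: (i) $\Delta_0$ coincides with the limit as $c_2\to\infty$ of the exogenous-price capacity wedge $$D(K)=r\bigl[\eta(2K)-\eta(K)+K(\eta'(2K)-\eta'(K))\bigr]+\frac{r^2}{c_2}\bigl[\eta(2K)\eta'(2K)-\eta(K)\eta'(K)\bigr],$$ with $a$ in the role of $r$. Its sign is not determined by the monotonicity and concavity of $\eta$ alone. (ii) The term $-3bK\bigl(\eta(2K)^2-\eta(K)^2\bigr)$ in $\Delta_{\mathrm{comp}}$ is strictly negative. (iii) If $4\eta(2K)\eta'(2K)\geq 3\eta(K)\eta'(K)$, then $\Delta_{\mathrm{comp}}(K)<0$, and hence $\Delta(K)<\Delta_0(K)$.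
   Context: Parameters: $a>0$, $b>0$ (inverse demand $P(Q)=a-bQ$ in each period), $c_1\in(0,\infty)$ (period-1 capacity cost coefficient), $\delta\in(0,1]$ (discount factor). In the expression $D$ of part (i), $r>0$ is a per-unit revenue (exogenous price) and $c_2>0$ a period-2 expansion cost coefficient. The learning curve $\eta:[0,\infty)\to[0,\infty)$ is twice continuously differentiable, strictly increasing, strictly concave and bounded; $\eta_{\min}:=\eta(0)$. Two symmetric firms each choose a single capacity $K_i\ge 0$ used in both periods (the limit $c_2\to\infty$ of infinite period-2 expansion cost). Firm $i$'s profit in regime $R\in\{P,F\}$ is $$\pi_i^R=\bigl[a-b\eta_{\min}(K_i+K_j)\bigr]K_i\eta_{\min}-\tfrac{c_1}{2}K_i^2+\delta\bigl[a-b(K_i\eta_{i,2}+K_j\eta_{j,2})\bigr]K_i\eta_{i,2},$$ where $\eta_{i,2}=\eta_{j,2}=\eta(K_i+K_j)$ under pooling ($R=P$), and $\eta_{i,2}=\eta(K_i)$, $\eta_{j,2}=\eta(K_j)$ under fragmentation ($R=F$). The derivative of $\pi_i^R$ with respect to $K_i$ ($K_j$ fixed), evaluated at $K_i=K_j=K$, is $$F^R(K):=a\eta_{\min}-(3b\eta_{\min}^2+c_1)K+\delta g^R(K),$$ $$g^F(K)=\bigl(\eta(K)+K\eta'(K)\bigr)\bigl(a-3bK\eta(K)\bigr),$$ $$g^P(K)=\eta(2K)\bigl(a-3bK\eta(2K)\bigr)+K\eta'(2K)\bigl(a-4bK\eta(2K)\bigr).$$ The symmetric period-1 equilibrium capacity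 $K^R_\star$ in regime $R$ is the root of $F^R$. *)

theory Defs
  imports "HOL-Analysis.Analysis"
begin

definition strict_concave_on :: "real set \<Rightarrow> (real \<Rightarrow> real) \<Rightarrow> bool" where
  "strict_concave_on S f \<longleftrightarrow> convex S \<and>
     (\<forall>x\<in>S. \<forall>y\<in>S. \<forall>t. x \<noteq> y \<longrightarrow> 0 < t \<longrightarrow> t < 1 \<longrightarrow>
        (1 - t) * f x + t * f y < f ((1 - t) * x + t * y))"

(* Derivatives are taken within S, so they are one-sided at a boundary point. *)
definition twice_continuously_differentiable_on :: "(real \<Rightarrow> real) \<Rightarrow> real set \<Rightarrow> bool" where
  "twice_continuously_differentiable_on f S \<longleftrightarrow>
     (\<exists>f' f''. (\<forall>x\<in>S. (f has_real_derivative f' x) (at x within S)) \<and>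
              (\<forall>x\<in>S. (f' has_real_derivative f'' x) (at x within S)) \<and>
              continuous_on S f'')"

(* A curve with domain [0,\<infinity>) is a total function whose values at negative arguments are
   irrelevant. Below, deriv \<eta> is evaluated only at positive arguments, which are interior. *)
definition learning_curve :: "(real \<Rightarrow> real) \<Rightarrow> bool" where
  "learning_curve \<eta> \<longleftrightarrow>
     (\<forall>x\<ge>0. 0 \<le> \<eta> x) \<and>
     twice_continuously_differentiable_on \<eta> {0..} \<and>
     strict_mono_on {0..} \<eta> \<and>
     strict_concave_on {0..} \<eta> \<and>
     bounded (\<eta> ` {0..})"

datatype regime = Pooling | Fragmentation

(* Period-2 effectiveness of a firm with capacity k whose rival has capacity k'. *)
fun effectiveness2 :: "regime \<Rightarrow> (real \<Rightarrow> real) \<Rightarrow> real \<Rightarrow> real \<Rightarrow> real" where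
  "effectiveness2 Pooling \<eta> k k' = \<eta> (k + k')"
| "effectiveness2 Fragmentation \<eta> k k' = \<eta> k"

definition profit ::
  "real \<Rightarrow> real \<Rightarrow> real \<Rightarrow> real \<Rightarrow> (real \<Rightarrow> real) \<Rightarrow> regime \<Rightarrow> real \<Rightarrow> real \<Rightarrow> real" where
  "profit a b c1 \<delta> \<eta> R Ki Kj =
     (a - b * \<eta> 0 * (Ki + Kj)) * Ki * \<eta> 0 - c1 / 2 * Ki\<^sup>2
     + \<delta> * (a - b * (Ki * effectiveness2 R \<eta> Ki Kj + Kj * effectiveness2 R \<eta> Kj Ki))
         * Ki * effectiveness2 R \<eta> Ki Kj"

fun marginal_profit2 :: "real \<Rightarrow> real \<Rightarrow> (real \<Rightarrow> real) \<Rightarrow> regime \<Rightarrow> real \<Rightarrow> real" where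
  "marginal_profit2 a b \<eta> Fragmentation K =
     (\<eta> K + K * deriv \<eta> K) * (a - 3 * b * K * \<eta> K)"
| "marginal_profit2 a b \<eta> Pooling K =
     \<eta> (2 * K) * (a - 3 * b * K * \<eta> (2 * K))
     + K * deriv \<eta> (2 * K) * (a - 4 * b * K * \<eta> (2 * K))"

definition marginal_profit ::
  "real \<Rightarrow> real \<Rightarrow> real \<Rightarrow> real \<Rightarrow> (real \<Rightarrow> real) \<Rightarrow> regime \<Rightarrow> real \<Rightarrow> real" where
  "marginal_profit a b c1 \<delta> \<eta> R K =
     a * \<eta> 0 - (3 * b * (\<eta> 0)\<^sup>2 + c1) * K + \<delta> * marginal_profit2 a b \<eta> R K"

lemma learning_curve_has_deriv:
  assumes "learning_curve \<eta>" "0 < x"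
  shows "(\<eta> has_real_derivative deriv \<eta> x) (at x)"
proof -
  obtain f' where "(\<eta> has_real_derivative f' x) (at x within {0..})"
    using assms
    unfolding learning_curve_def twice_continuously_differentiable_on_def by (meson atLeast_iff less_imp_le)
  moreover have "at x within {0..} = at x"
    using assms(2) by (intro at_within_interior) simp
  ultimately show ?thesis
    by (metis DERIV_imp_deriv)
qed

lemma cournot_profit_has_derivative:
  fixes f g :: "real \<Rightarrow> real"
  assumes "(f has_real_derivative f') (at K)" "(g has_real_derivative g') (at K)"
  shows "((\<lambda>k. (a - b * n * (k + K)) * k * n - c / 2 * k\<^sup>2
              + \<delta> * (a - b * (k * f k + K * g k)) * k * f k) has_real_derivative
          a * n - 3 * b * n\<^sup>2 * K - c * K
            + \<delta> * ((a - b * K * (f K + g K)) * (f K + K * f')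
                   - b * K * f K * (f K + K * f' + K * g'))) (at K)"
  apply (rule DERIV_cong)
   apply (rule assms DERIV_ident DERIV_const DERIV_add DERIV_diff DERIV_mult DERIV_power)+
  apply simp
  apply (simp add: algebra_simps power2_eq_square)
  done

lemma profit_has_derivative_marginal_profit:
  assumes "learning_curve \<eta>" "0 < K"
  shows "((\<lambda>Ki. profit a b c1 \<delta> \<eta> R Ki K) has_real_derivative
           marginal_profit a b c1 \<delta> \<eta> R K) (at K)"
proof (cases R)
  case Pooling
  have "(\<eta> has_real_derivative deriv \<eta> (2 * K)) (at (K + K))"
    using learning_curve_has_deriv[OF assms(1), of "2 * K"] assms(2) by (metis mult_2 add_pos_pos)
  then have d: "((\<lambda>k. \<eta> (k + K)) has_real_derivative deriv \<eta> (2 * K)) (at K)"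
    by (rule iffD1[OF DERIV_shift])
  have d': "((\<lambda>k. \<eta> (K + k)) has_real_derivative deriv \<eta> (2 * K)) (at K)"
    by (subst add.commute) (rule d)
  have "\<eta> (K + K) = \<eta> (2 * K)"
    by (simp only: mult_2)
  show ?thesis
    unfolding profit_def Pooling effectiveness2.simps marginal_profit_def marginal_profit2.simps
    apply (rule DERIV_cong[OF cournot_profit_has_derivative[OF d d']])
    apply (simp only: \<open>\<eta> (K + K) = \<eta> (2 * K)\<close>)
    apply (simp add: algebra_simps power2_eq_square)
    done
next
  case Fragmentation
  have d: "(\<eta> has_real_derivative deriv \<eta> K) (at K)"
    by (rule learning_curve_has_deriv[OF assms])
  have d': "((\<lambda>k. \<eta> K) has_real_derivative 0) (at K)"
    by (rule DERIV_const)
  show ?thesis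
    unfolding profit_def Fragmentation effectiveness2.simps marginal_profit_def marginal_profit2.simps
    apply (rule DERIV_cong[OF cournot_profit_has_derivative[OF d d']])
    apply (simp add: algebra_simps power2_eq_square)
    done
qed

(* Meaningful only when the positive root is unique. *)
definition equilibrium_capacity ::
  "real \<Rightarrow> real \<Rightarrow> real \<Rightarrow> real \<Rightarrow> (real \<Rightarrow> real) \<Rightarrow> regime \<Rightarrow> real" where
  "equilibrium_capacity a b c1 \<delta> \<eta> R = (THE K. 0 < K \<and> marginal_profit a b c1 \<delta> \<eta> R K = 0)"

definition wedge0 :: "real \<Rightarrow> (real \<Rightarrow> real) \<Rightarrow> real \<Rightarrow> real" where
  "wedge0 a \<eta> K = a * ((\<eta> (2 * K) - \<eta> K) + K * (deriv \<eta> (2 * K) - deriv \<eta> K))"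

definition wedge_comp :: "real \<Rightarrow> (real \<Rightarrow> real) \<Rightarrow> real \<Rightarrow> real" where
  "wedge_comp b \<eta> K =
     - 3 * b * K * ((\<eta> (2 * K))\<^sup>2 - (\<eta> K)\<^sup>2)
     - b * K\<^sup>2 * (4 * \<eta> (2 * K) * deriv \<eta> (2 * K) - 3 * \<eta> K * deriv \<eta> K)"

definition wedge :: "real \<Rightarrow> real \<Rightarrow> (real \<Rightarrow> real) \<Rightarrow> real \<Rightarrow> real" where
  "wedge a b \<eta> K = wedge0 a \<eta> K + wedge_comp b \<eta> K"

definition exogenous_price_wedge :: "real \<Rightarrow> real \<Rightarrow> (real \<Rightarrow> real) \<Rightarrow> real \<Rightarrow> real" where
  "exogenous_price_wedge r c2 \<eta> K =
     r * (\<eta> (2 * K) - \<eta> K + K * (deriv \<eta> (2 * K) - deriv \<eta> K))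
     + r\<^sup>2 / c2 * (\<eta> (2 * K) * deriv \<eta> (2 * K) - \<eta> K * deriv \<eta> K)"

end

theory Submission
  imports Defs
begin

text \<open>Subtracting the two first-order conditions at a common capacity leaves \<open>\<delta>\<close> times the wedge.
  At the root of \<open>F\<^sup>F\<close> the wedge therefore has the sign of \<open>F\<^sup>P\<close>, and since \<open>F\<^sup>P\<close> is strictly
  decreasing this sign places the root of \<open>F\<^sup>P\<close>. For the indeterminacy in part (i), the curve
  \<open>1 - exp (- s x)\<close> has \<open>\<Delta>\<^sub>0 K = a (1 - s K) (exp (- s K) - exp (- 2 s K))\<close>, whose sign changes
  at \<open>s K = 1\<close>.\<close>

text \<open>Equality \<open>exp z = 1 + z\<close> would say that \<open>ln\<close> meets its tangent
  \<open>w - 1\<close> at \<open>w = exp z\<close>, which happens only at \<open>w = 1\<close>, that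
  is, at \<open>z = 0\<close>.\<close>

lemma exp_greater_add_one_self:
  fixes z :: real
  assumes "z \<noteq> 0"
  shows "1 + z < exp z"
proof -
  have "exp z \<noteq> 1 + z"
    using assms ln_eq_minus_one[of "exp z"] by auto
  then show ?thesis
    using exp_ge_add_one_self[of z] by linarith
qed

lemma strict_concave_on_neg_exp:
  fixes s :: real
  assumes "s \<noteq> 0" and "convex S"
  shows "strict_concave_on S (\<lambda>x. 1 - exp (- s * x))"
  unfolding strict_concave_on_def
proof (intro conjI ballI allI impI)
  fix x y t :: real
  assume "x \<noteq> y" "0 < t" "t < 1"
  define m where "m = (1 - t) * x + t * y"
  \<comment> \<open>Away from \<open>m\<close> the graph of \<open>exp (- s * z)\<close> lies
    strictly above its tangent at the mixing point \<open>m\<close>. This is the previous inequality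
    at \<open>- s * (z - m)\<close>, scaled by \<open>exp (- s * m)\<close>.\<close>
  have tangent: "exp (- s * m) * (1 - s * (z - m)) < exp (- s * z)" if "z \<noteq> m" for z
  proof -
    have "1 + (- s * (z - m)) < exp (- s * (z - m))"
      using that \<open>s \<noteq> 0\<close> by (intro exp_greater_add_one_self) simp
    then have "exp (- s * m) * (1 + (- s * (z - m))) < exp (- s * m) * exp (- s * (z - m))"
      by simp
    also have "\<dots> = exp (- s * z)"
      by (simp add: algebra_simps flip: exp_add)
    finally show ?thesis by simp
  qed
  have xm: "x - m = t * (x - y)" and ym: "y - m = (1 - t) * (y - x)"
    by (simp_all add: m_def algebra_simps)
  then have "x \<noteq> m" "y \<noteq> m"
    using \<open>x \<noteq> y\<close> \<open>0 < t\<close> \<open>t < 1\<close> by auto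
  \<comment> \<open>The linear terms cancel: \<open>x - m\<close> and \<open>y - m\<close> have
    weighted mean zero.\<close>
  have "exp (- s * m) = (1 - t) * (exp (- s * m) * (1 - s * (x - m)))
      + t * (exp (- s * m) * (1 - s * (y - m)))"
    unfolding xm ym by (simp add: algebra_simps)
  also have "\<dots> < (1 - t) * exp (- s * x) + t * exp (- s * y)"
    using \<open>0 < t\<close> \<open>t < 1\<close> tangent[OF \<open>x \<noteq> m\<close>] tangent[OF \<open>y \<noteq> m\<close>]
    by (intro add_strict_mono mult_strict_left_mono) auto
  finally show "(1 - t) * (1 - exp (- s * x)) + t * (1 - exp (- s * y))
      < 1 - exp (- s * ((1 - t) * x + t * y))"
    by (simp add: m_def algebra_simps)
qed (rule assms(2))

lemma DERIV_exp_curve: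
  fixes s :: real
  shows "((\<lambda>x. 1 - exp (- s * x)) has_real_derivative s * exp (- s * x)) (at x within S)"
  by (auto intro!: derivative_eq_intros)

text \<open>Supplies witnesses for part (i); the free rate \<open>s\<close> lets
  \<open>s * K\<close> be placed on either side of 1.\<close>

lemma learning_curve_exp:
  fixes s :: real
  assumes "s > 0"
  shows "learning_curve (\<lambda>x. 1 - exp (- s * x))"
  unfolding learning_curve_def
proof (intro conjI)
  show "\<forall>x\<ge>0. 0 \<le> 1 - exp (- s * x)"
    using assms by simp
  have "((\<lambda>x. s * exp (- s * x)) has_real_derivative - s * s * exp (- s * x)) (at x within {0..})"
    for x
    by (auto intro!: derivative_eq_intros)
  moreover have "continuous_on {0..} (\<lambda>x. - s * s * exp (- s * x))"
    by (intro continuous_intros)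
  ultimately show "twice_continuously_differentiable_on (\<lambda>x. 1 - exp (- s * x)) {0..}"
    unfolding twice_continuously_differentiable_on_def
    by - (rule exI[where x = "\<lambda>x. s * exp (- s * x)"],
        rule exI[where x = "\<lambda>x. - s * s * exp (- s * x)"],
        intro conjI ballI DERIV_exp_curve)
  show "strict_mono_on {0..} (\<lambda>x. 1 - exp (- s * x))"
    using assms by (intro strict_mono_onI) simp
  show "strict_concave_on {0..} (\<lambda>x. 1 - exp (- s * x))"
    using assms by (intro strict_concave_on_neg_exp) simp_all
  show "bounded ((\<lambda>x. 1 - exp (- s * x)) ` {0..})"
    using assms by (intro boundedI[of _ 1]) auto
qed

text \<open>Since \<eta>' = s (1 - \<eta>) for this curve, the change in slope from \<open>K\<close>
  to \<open>2 * K\<close> is \<open>- s\<close> times the change in level, so the level gap factors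
  out.\<close>

lemma wedge0_exp_curve:
  "wedge0 a (\<lambda>x. 1 - exp (- s * x)) K = a * (1 - s * K) * (exp (- s * K) - exp (- s * (2 * K)))"
proof -
  have "deriv (\<lambda>x. 1 - exp (- s * x)) x = s * exp (- s * x)" for x :: real
    by (intro DERIV_imp_deriv DERIV_exp_curve)
  then show ?thesis
    unfolding wedge0_def by (simp add: algebra_simps)
qed

lemma wedge0_sign_indeterminate:
  assumes "a > 0" and "K > 0"
  shows "\<exists>\<theta>. learning_curve \<theta> \<and> wedge0 a \<theta> K > 0"
    and "\<exists>\<theta>. learning_curve \<theta> \<and> wedge0 a \<theta> K < 0"
proof -
  have gap: "exp (- s * K) - exp (- s * (2 * K)) > 0" if "s > 0" for s
    using that assms by simp
  have "1 / (2 * K) > 0" "2 / K > 0"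
    using assms by simp_all
  \<comment> \<open>Here \<open>s * K = 1 / 2\<close>, so the factor \<open>1 - s * K\<close> is
    \<open>1 / 2\<close>.\<close>
  moreover have "wedge0 a (\<lambda>x. 1 - exp (- (1 / (2 * K)) * x)) K > 0"
    unfolding wedge0_exp_curve using assms
    by (intro mult_pos_pos gap) (simp_all add: field_simps)
  \<comment> \<open>Here \<open>s * K = 2\<close>, so the factor \<open>1 - s * K\<close> is
    \<open>-1\<close>.\<close>
  moreover have "wedge0 a (\<lambda>x. 1 - exp (- (2 / K) * x)) K < 0"
    unfolding wedge0_exp_curve using assms
    by (intro mult_neg_pos[OF mult_pos_neg gap]) (simp_all add: field_simps)
  ultimately show "\<exists>\<theta>. learning_curve \<theta> \<and> wedge0 a \<theta> K > 0"
    and "\<exists>\<theta>. learning_curve \<theta> \<and> wedge0 a \<theta> K < 0"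
    using learning_curve_exp by blast+
qed

text \<open>The period-1 revenue and capacity cost terms are the same in both regimes and cancel.
  What remains is \<delta> times the difference of the period-2 terms, regrouped by whether they
  carry \<open>a\<close> or \<open>b\<close>.\<close>

lemma marginal_profit_diff:
  "marginal_profit a b c1 \<delta> \<eta> Pooling K - marginal_profit a b c1 \<delta> \<eta> Fragmentation K
     = \<delta> * wedge a b \<eta> K"
  by (simp add: marginal_profit_def wedge_def wedge0_def wedge_comp_def
      algebra_simps power2_eq_square)

text \<open>A strictly decreasing function is positive left of its zero and negative right of it;
  trichotomy turns these implications into equivalences.\<close>

lemma strict_antimono_on_root_compare:
  fixes f :: "real \<Rightarrow> real"
  assumes "strict_antimono_on S f" and "x \<in> S" and "z \<in> S" and "f z = 0"
  shows "z > x \<longleftrightarrow> f x > 0" and "z = x \<longleftrightarrow> f x = 0" and "z < x \<longleftrightarrow> f x < 0"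
proof -
  have "x < z \<Longrightarrow> f x > 0" "z < x \<Longrightarrow> f x < 0"
    using monotone_onD[OF assms(1)] assms(2-4) by fastforce+
  then show "z > x \<longleftrightarrow> f x > 0" "z = x \<longleftrightarrow> f x = 0" "z < x \<longleftrightarrow> f x < 0"
    using assms(4) by (cases x z rule: linorder_cases; force)+
qed

lemma equilibrium_capacity_root:
  assumes "\<exists>!K. 0 < K \<and> marginal_profit a b c1 \<delta> \<eta> R K = 0"
  shows "0 < equilibrium_capacity a b c1 \<delta> \<eta> R"
    and "marginal_profit a b c1 \<delta> \<eta> R (equilibrium_capacity a b c1 \<delta> \<eta> R) = 0"
  using theI'[OF assms] unfolding equilibrium_capacity_def by auto

text \<open>Only the expansion term depends on \<open>c2\<close>, and its coefficient
  \<open>a\<^sup>2 / c2\<close> vanishes in the limit.\<close>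

lemma exogenous_price_wedge_tendsto:
  "((\<lambda>c2. exogenous_price_wedge a c2 \<eta> K) \<longlongrightarrow> wedge0 a \<eta> K) at_top"
proof -
  have "((\<lambda>c2. a\<^sup>2 / c2) \<longlongrightarrow> 0) at_top"
    by (intro tendsto_divide_0[OF tendsto_const] filterlim_at_top_imp_at_infinity filterlim_ident)
  then have "((\<lambda>c2. exogenous_price_wedge a c2 \<eta> K) \<longlongrightarrow>
      wedge0 a \<eta> K + 0 * (\<eta> (2 * K) * deriv \<eta> (2 * K) - \<eta> K * deriv \<eta> K)) at_top"
    unfolding exogenous_price_wedge_def wedge0_def by (intro tendsto_intros)
  then show ?thesis by simp
qed

text \<open>Squaring keeps the strict increase from \<open>K\<close> to \<open>2 * K\<close> because
  the curve is nonnegative.\<close>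

lemma learning_curve_square_gap:
  assumes "learning_curve \<eta>" and "b > 0" and "K > 0"
  shows "- 3 * b * K * ((\<eta> (2 * K))\<^sup>2 - (\<eta> K)\<^sup>2) < 0"
proof -
  have "0 \<le> \<eta> K" "\<eta> K < \<eta> (2 * K)"
    using assms unfolding learning_curve_def by (auto simp: strict_mono_on_def)
  then have "(\<eta> K)\<^sup>2 < (\<eta> (2 * K))\<^sup>2"
    by (intro power_strict_mono) auto
  then show ?thesis
    using assms(2,3) by (intro mult_neg_pos) auto
qed

lemma wedge_comp_neg:
  assumes "learning_curve \<eta>" and "b > 0" and "K > 0"
    and "4 * \<eta> (2 * K) * deriv \<eta> (2 * K) \<ge> 3 * \<eta> K * deriv \<eta> K"
  shows "wedge_comp b \<eta> K < 0"
proof -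
  have "b * K\<^sup>2 * (4 * \<eta> (2 * K) * deriv \<eta> (2 * K) - 3 * \<eta> K * deriv \<eta> K) \<ge> 0"
    using assms by (intro mult_nonneg_nonneg) auto
  then show ?thesis
    using learning_curve_square_gap[OF assms(1-3)] unfolding wedge_comp_def by linarith
qed

theorem proposition6:
  fixes a b c1 \<delta> :: real and \<eta> :: "real \<Rightarrow> real"
  assumes "a > 0" and "b > 0" and "c1 > 0" and "0 < \<delta>" and "\<delta> \<le> 1"
    and "learning_curve \<eta>"
    and "\<And>R. strict_antimono_on {0<..} (marginal_profit a b c1 \<delta> \<eta> R)"
    and "\<And>R. \<exists>!K. 0 < K \<and> marginal_profit a b c1 \<delta> \<eta> R K = 0"
  defines "KP \<equiv> equilibrium_capacity a b c1 \<delta> \<eta> Pooling"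
    and "KF \<equiv> equilibrium_capacity a b c1 \<delta> \<eta> Fragmentation"
  shows "(KP > KF \<longleftrightarrow> wedge a b \<eta> KF > 0) \<and>
         (KP = KF \<longleftrightarrow> wedge a b \<eta> KF = 0) \<and>
         (KP < KF \<longleftrightarrow> wedge a b \<eta> KF < 0) \<and>
         (\<forall>K>0. ((\<lambda>c2. exogenous_price_wedge a c2 \<eta> K) \<longlongrightarrow> wedge0 a \<eta> K) at_top) \<and>
         (\<forall>K>0. (\<exists>\<theta>. learning_curve \<theta> \<and> wedge0 a \<theta> K > 0) \<and>
                (\<exists>\<theta>. learning_curve \<theta> \<and> wedge0 a \<theta> K < 0)) \<and>
         (\<forall>K>0. - 3 * b * K * ((\<eta> (2 * K))\<^sup>2 - (\<eta> K)\<^sup>2) < 0) \<and>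
         (\<forall>K>0. 4 * \<eta> (2 * K) * deriv \<eta> (2 * K) \<ge> 3 * \<eta> K * deriv \<eta> K \<longrightarrow>
                wedge_comp b \<eta> K < 0 \<and> wedge a b \<eta> K < wedge0 a \<eta> K)"
proof -
  let ?F = "marginal_profit a b c1 \<delta> \<eta>"
  have roots: "0 < KP" "?F Pooling KP = 0" "0 < KF" "?F Fragmentation KF = 0"
    unfolding KP_def KF_def using equilibrium_capacity_root[OF assms(8)] by blast+
  \<comment> \<open>The fragmentation term of the difference vanishes at its own root
    \<open>KF\<close>.\<close>
  then have "?F Pooling KF = \<delta> * wedge a b \<eta> KF"
    using marginal_profit_diff[of a b c1 \<delta> \<eta> KF] by simp
  then have sign: "?F Pooling KF > 0 \<longleftrightarrow> wedge a b \<eta> KF > 0"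
      "?F Pooling KF = 0 \<longleftrightarrow> wedge a b \<eta> KF = 0"
      "?F Pooling KF < 0 \<longleftrightarrow> wedge a b \<eta> KF < 0"
    using \<open>0 < \<delta>\<close> by (simp_all add: zero_less_mult_iff mult_less_0_iff)
  have compare: "KP > KF \<longleftrightarrow> ?F Pooling KF > 0" "KP = KF \<longleftrightarrow> ?F Pooling KF = 0"
      "KP < KF \<longleftrightarrow> ?F Pooling KF < 0"
    using strict_antimono_on_root_compare[OF assms(7)[of Pooling], of KF KP] roots
    by simp_all
  have "wedge_comp b \<eta> K < 0 \<and> wedge a b \<eta> K < wedge0 a \<eta> K"
    if "K > 0" "4 * \<eta> (2 * K) * deriv \<eta> (2 * K) \<ge> 3 * \<eta> K * deriv \<eta> K" for K
    using wedge_comp_neg[OF assms(6,2) that] by (simp add: wedge_def)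
  then show ?thesis
    using sign compare exogenous_price_wedge_tendsto wedge0_sign_indeterminate[OF assms(1)]
      learning_curve_square_gap[OF assms(6,2)]
    by blast
qed

end
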